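(* Let $(X,T)$ be a dynamical system and $\mathscr{F}$ be a Furstenberg family. Suppose that $A$ is a closed subset of $X$ with at least two points. Then $A$ is an $\mathscr{F}$-mixing set if and only if for every $S\in\kappa\mathscr{F}$ there are Cantor subsets $C_1\subset C_2\subset \dotsb$ of $A$ such that (i) $K=\bigcup_{n=1}^\infty C_n$ is dense in $A$; (ii) for any $n\in\mathbb{N}$ and any continuous function $g\colon C_n\to A$ there exists a subsequence $\{q_i\}$ of $S$ such that $\lim_{i\to\infty} T^{q_i}(x)=g(x)$ uniformly on $x\in C_n$; (iii) for any subset $E$ of $K$ and any continuous map $g \colon E\to A$ there exists a subsequence $\{q_i\}$ of $S$ such that $\lim_{i\to\infty} T^{q_i}(x)=g(x)$ for every $x\in E$.
   Context: A dynamical system is a pair $(X,T)$, where $X$ is a non-empty compact metric space and $T$ is a homeomorphism from $X$ to itself. $\mathbb{N}$ is the set of positive integers. A Furstenberg family is a collection $\mathscr{F}$ of subsets of $\mathbb{N}$ that is hereditary upward ($F_1\subset F_2$ and $F_1\in\mathscr{F}$ imply $F_2\in\mathscr{F}$). Convention: all families are assumed proper (neither empty nor the collection of all subsets of $\mathbb{N}$) and contained in the family of all infinite subsets of $\mathbb{N}$. The dual family is $\kappa\mathscr{F}=\{F\subset\mathbb{N}\colon F\cap F'\neq\emptyset \text{ for all } F'\in\mathscr{F}\}$. For $U,V\subset X$, $N(U,V)=\{n\in\mathbb{N}\colon U\cap T^{-n}(V)\neq\emptyset\}$. A closed subset $A$ of $X$ with at least two points is called $\mathscr{F}$-mixing if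 for any $k\in\mathbb{N}$ and any open subsets $U_1,\dots,U_k,V_1,\dots,V_k$ of $X$ each intersecting $A$, one has $\bigcap_{i=1}^k N(U_i\cap A,V_i)\in\mathscr{F}$. A Cantor subset is a subset homeomorphic to the Cantor set. A subsequence of $S\subset\mathbb{N}$ means a (strictly increasing) infinite sequence of elements of $S$. *)

theory Defs
  imports "HOL-Analysis.Analysis"
begin

text \<open>
  Dynamical systems live on a carrier set inside a metric space type; the set of positive
  integers is written \<open>{1..} :: nat set\<close>.
\<close>

definition dynamical_system :: "'a::metric_space set \<Rightarrow> ('a \<Rightarrow> 'a) \<Rightarrow> bool" where
  "dynamical_system X T \<longleftrightarrow> X \<noteq> {} \<and> compact X \<and> (\<exists>T'. homeomorphism X X T T')"

definition furstenberg_family :: "nat set set \<Rightarrow> bool" where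
  "furstenberg_family \<F> \<longleftrightarrow>
     \<F> \<subseteq> Pow {1..} \<and>
     (\<forall>F\<^sub>1 F\<^sub>2. F\<^sub>1 \<in> \<F> \<longrightarrow> F\<^sub>1 \<subseteq> F\<^sub>2 \<longrightarrow> F\<^sub>2 \<subseteq> {1..} \<longrightarrow> F\<^sub>2 \<in> \<F>)"

definition proper_family :: "nat set set \<Rightarrow> bool" where
  "proper_family \<F> \<longleftrightarrow> \<F> \<noteq> {} \<and> \<F> \<noteq> Pow {1..}"

definition dual_family :: "nat set set \<Rightarrow> nat set set" where
  "dual_family \<F> = {F. F \<subseteq> {1..} \<and> (\<forall>F'\<in>\<F>. F \<inter> F' \<noteq> {})}"

definition hitting_times :: "'a set \<Rightarrow> ('a \<Rightarrow> 'a) \<Rightarrow> 'a set \<Rightarrow> 'a set \<Rightarrow> nat set" where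
  "hitting_times X T U V = {n \<in> {1..}. U \<inter> {x \<in> X. (T ^^ n) x \<in> V} \<noteq> {}}"

definition mixing_set ::
  "nat set set \<Rightarrow> 'a::metric_space set \<Rightarrow> ('a \<Rightarrow> 'a) \<Rightarrow> 'a set \<Rightarrow> bool" where
  "mixing_set \<F> X T A \<longleftrightarrow>
     closedin (top_of_set X) A \<and> (\<exists>x\<in>A. \<exists>y\<in>A. x \<noteq> y) \<and>
     (\<forall>k\<ge>1. \<forall>U V :: nat \<Rightarrow> 'a set.
        (\<forall>i\<in>{1..k}. openin (top_of_set X) (U i) \<and> U i \<inter> A \<noteq> {} \<and>
                    openin (top_of_set X) (V i) \<and> V i \<inter> A \<noteq> {}) \<longrightarrow>
        (\<Inter>i\<in>{1..k}. hitting_times X T (U i \<inter> A) (V i)) \<in> \<F>)"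

text \<open>
  The middle-thirds Cantor set: the reals in the unit interval that have a ternary expansion
  using only the digits 0 and 2.
\<close>

definition cantor_point :: "(nat \<Rightarrow> bool) \<Rightarrow> real" where
  "cantor_point b = (\<Sum>n. (if b n then 2 else 0) / 3 ^ Suc n)"

definition cantor_set :: "real set" where
  "cantor_set = range cantor_point"

definition cantor_subset :: "'a::metric_space set \<Rightarrow> 'a set \<Rightarrow> bool" where
  "cantor_subset C A \<longleftrightarrow> C \<subseteq> A \<and> C homeomorphic cantor_set"

definition subsequence_of :: "(nat \<Rightarrow> nat) \<Rightarrow> nat set \<Rightarrow> bool" where
  "subsequence_of q S \<longleftrightarrow> strict_mono q \<and> range q \<subseteq> S"

lemma cantor_point_summable:
  "summable (\<lambda>n. (if b n then 2 else 0 :: real) / 3 ^ Suc n)"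
proof (rule summable_comparison_test')
  show "summable (\<lambda>n. 2/3 * (1/3 :: real) ^ n)"
    by (intro summable_mult summable_geometric) auto
  show "norm ((if b n then 2 else 0 :: real) / 3 ^ Suc n) \<le> 2/3 * (1/3) ^ n" for n
    by (auto simp: field_simps)
qed

lemma cantor_point_shift:
  "cantor_point b = (if b 0 then 2/3 else 0) + cantor_point (\<lambda>n. b (Suc n)) / 3"
proof -
  let ?t = "\<lambda>n. (if b n then 2 else 0 :: real) / 3 ^ Suc n"
  have "cantor_point b = ?t 0 + (\<Sum>n. ?t (Suc n))"
    unfolding cantor_point_def using suminf_split_head[OF cantor_point_summable[of b]] by simp
  also have "(\<Sum>n. ?t (Suc n)) = (\<Sum>n. ((if b (Suc n) then 2 else 0) / 3 ^ Suc n) / 3)"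
    by (intro suminf_cong) auto
  also have "\<dots> = cantor_point (\<lambda>n. b (Suc n)) / 3"
    unfolding cantor_point_def
    using suminf_divide[OF cantor_point_summable[of "\<lambda>n. b (Suc n)"], of 3] by simp
  finally show ?thesis by simp
qed

lemma cantor_point_bounds: "0 \<le> cantor_point b" "cantor_point b \<le> 1"
proof -
  show "0 \<le> cantor_point b"
    unfolding cantor_point_def by (intro suminf_nonneg cantor_point_summable) auto
  have g: "(\<lambda>n. 2/3 * (1/3 :: real) ^ n) sums (2/3 * (1 / (1 - 1/3)))"
    by (intro sums_mult geometric_sums) auto
  have "cantor_point b \<le> (\<Sum>n. 2/3 * (1/3 :: real) ^ n)"
    unfolding cantor_point_def
    by (intro suminf_le cantor_point_summable sums_summable[OF g]) (auto simp: field_simps)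
  also have "\<dots> = 1" using sums_unique[OF g] by simp
  finally show "cantor_point b \<le> 1" .
qed

lemma cantor_point_eqD: "cantor_point b = cantor_point c \<Longrightarrow> b n = c n"
proof (induction n arbitrary: b c)
  case 0
  then show ?case
    using cantor_point_shift[of b] cantor_point_shift[of c]
      cantor_point_bounds[of "\<lambda>n. b (Suc n)"] cantor_point_bounds[of "\<lambda>n. c (Suc n)"]
    by (auto split: if_splits)
next
  case (Suc n)
  have "b 0 = c 0"
    using Suc.prems cantor_point_shift[of b] cantor_point_shift[of c]
      cantor_point_bounds[of "\<lambda>n. b (Suc n)"] cantor_point_bounds[of "\<lambda>n. c (Suc n)"]
    by (auto split: if_splits)
  then have "cantor_point (\<lambda>n. b (Suc n)) = cantor_point (\<lambda>n. c (Suc n))"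
    using Suc.prems cantor_point_shift[of b] cantor_point_shift[of c] by auto
  then show ?case by (rule Suc.IH)
qed

lemma inj_cantor_point: "inj cantor_point"
  by (intro injI ext) (rule cantor_point_eqD)

lemma continuous_on_cantor_point: "continuous_on UNIV cantor_point"
proof -
  have "uniform_limit UNIV (\<lambda>n b. \<Sum>i<n. (if b i then 2 else 0 :: real) / 3 ^ Suc i)
          (\<lambda>b. \<Sum>i. (if b i then 2 else 0) / 3 ^ Suc i) sequentially"
  proof (rule Weierstrass_m_test)
    show "summable (\<lambda>n. 2/3 * (1/3 :: real) ^ n)"
      by (intro summable_mult summable_geometric) auto
  qed (auto simp: field_simps)
  moreover have "continuous_on UNIV (\<lambda>b. \<Sum>i<n. (if b i then 2 else 0 :: real) / 3 ^ Suc i)" for n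
  proof (intro continuous_on_sum)
    fix i
    have "continuous_on UNIV (\<lambda>b :: nat \<Rightarrow> bool. b i)"
      by (rule continuous_on_product_coordinates)
    moreover have "continuous_on UNIV (\<lambda>c. (if c then 2 else 0 :: real) / 3 ^ Suc i)"
      by (subst continuous_on_open_vimage) (auto intro: open_discrete)
    ultimately show "continuous_on UNIV (\<lambda>b. (if b i then 2 else 0 :: real) / 3 ^ Suc i)"
      using continuous_on_compose2[of UNIV "\<lambda>c. (if c then 2 else 0 :: real) / 3 ^ Suc i"
          UNIV "\<lambda>b. b i"] by blast
  qed
  ultimately have "continuous_on UNIV (\<lambda>b. \<Sum>i. (if b i then 2 else 0 :: real) / 3 ^ Suc i)"
    by (intro uniform_limit_theorem) auto
  then show ?thesis by (simp add: cantor_point_def[abs_def])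
qed

lemma compact_UNIV_cantor_space: "compact (UNIV :: (nat \<Rightarrow> bool) set)"
proof -
  have "compact_space (product_topology (\<lambda>_. euclidean :: bool topology) (UNIV :: nat set))"
    unfolding compact_space_product_topology
    by (rule disjI2) (simp add: compact_space_def finite_imp_compact)
  then show ?thesis
    unfolding euclidean_product_topology by (simp add: compact_space_def)
qed

lemma cantor_set_homeomorphic_cantor_space:
  "cantor_set homeomorphic (UNIV :: (nat \<Rightarrow> bool) set)"
proof -
  have "\<exists>g. homeomorphism UNIV cantor_set cantor_point g"
    by (rule homeomorphism_compact[OF compact_UNIV_cantor_space continuous_on_cantor_point
          cantor_set_def[symmetric] inj_cantor_point])
  then have "(UNIV :: (nat \<Rightarrow> bool) set) homeomorphic cantor_set"
    unfolding homeomorphic_def by blast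
  then show ?thesis using homeomorphic_sym by blast
qed

end

theory Submission
  imports Defs
begin

text \<open>
  If some intersection \<open>F\<close> of hitting times were not in \<open>\<F>\<close>, then its complement \<open>S\<close> would
  belong to the dual family. The dense union \<open>K\<close> of Cantor sets obtained for this \<open>S\<close> contains
  distinct points \<open>x i \<in> U i\<close>, since Cantor sets have no isolated points. Sending each \<open>x i\<close> to
  a point of \<open>V i \<inter> A\<close> is a continuous map on a finite set, and a time in \<open>S\<close> at which the iterate
  is close to this map lies in \<open>F\<close>, which is absurd
  (\<open>pointwise_approximation_imp_mixing_set\<close>).

  Conversely, let \<open>A\<close> be mixing and \<open>S\<close> be in the dual family. All the Cantor sets are produced at
  once as images of the blocks \<open>{j} \<times> 2\<^sup>\<omega>\<close> under one generic map \<open>\<phi>\<close> from \<open>\<nat> \<times> 2\<^sup>\<omega>\<close> to \<open>A\<close>. The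
  candidates for \<open>\<phi>\<close> are those continuous maps that send block \<open>j\<close> into the closure of
  \<open>A \<inter> W j\<close>, where the open sets \<open>W j\<close> are so many that the range of every candidate is dense in \<open>A\<close>.
  In the uniform metric they form a complete space. The map \<open>\<phi>\<close> is required to be steered by \<open>S\<close>
  (\<open>steers\<close>): whenever finitely many blocks are cut into cylinders and a target in \<open>A\<close> is
  prescribed for each cylinder, some arbitrarily late iterate with time in \<open>S\<close> moves every cylinder
  close to its target. For targets in a countable dense set these are countably many conditions.
  Each of them holds on a dense open set of candidates: a candidate is uniformly close to one that is
  constant on small cylinders, and mixing allows the finitely many values to be moved slightly so
  that a common time in \<open>S\<close> sends them to the targets (\<open>block_maps_perturb\<close>). So a Baire category
  argument (\<open>generic_uniform_limit\<close>) provides a steered \<open>\<phi>\<close>.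

  The rest follows from steering and continuity. Two points of \<open>\<nat> \<times> 2\<^sup>\<omega>\<close> can be given different targets,
  so \<open>\<phi>\<close> is injective and \<open>C n = \<phi> ` ({..n} \<times> 2\<^sup>\<omega>)\<close> is a Cantor set. A continuous map on \<open>C n\<close> is a
  uniform limit of maps constant on cylinders, which yields uniform approximation by iterates. A
  continuous map \<open>g\<close> on an arbitrary \<open>E \<subseteq> K\<close> may have no continuous extension, but prescribing for
  every cylinder that meets \<open>E\<close> the value of \<open>g\<close> at some point of \<open>E\<close> in it gives targets that
  converge to \<open>g\<close> at each point of \<open>E\<close>.
\<close>

section \<open>Iterates, dual families and hitting times\<close>

lemma funpow_closed: "T ` X \<subseteq> X \<Longrightarrow> (T ^^ n) ` X \<subseteq> X"
  by (induction n) auto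

lemma continuous_on_funpow:
  assumes "continuous_on X T" "T ` X \<subseteq> X"
  shows "continuous_on X (T ^^ n)"
proof (induction n)
  case 0
  show ?case by (auto simp: continuous_on_id)
next
  case (Suc n)
  have "continuous_on X (T \<circ> (T ^^ n))"
    using Suc assms(1) funpow_closed[OF assms(2)]
    by (intro continuous_on_compose) (auto intro: continuous_on_subset)
  then show ?case by simp
qed

lemma complement_in_dual_family:
  assumes "furstenberg_family \<F>" "F \<notin> \<F>" "F \<subseteq> {1..}"
  shows "{1..} - F \<in> dual_family \<F>"
  unfolding dual_family_def
proof (clarify, intro conjI ballI notI)
  fix F' assume F': "F' \<in> \<F>" "({1..} - F) \<inter> F' = {}"
  have "F' \<subseteq> {1..}" using F'(1) assms(1) unfolding furstenberg_family_def by blast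
  then have "F' \<subseteq> F" using F'(2) by blast
  then have "F \<in> \<F>" using F'(1) assms(1,3) unfolding furstenberg_family_def by metis
  then show False using assms(2) by contradiction
qed blast

lemma mixing_set_hits_finite:
  assumes mix: "mixing_set \<F> X T A" and S: "S \<in> dual_family \<F>"
    and P: "finite P" "P \<noteq> {}"
    and op: "\<And>U V. (U, V) \<in> P \<Longrightarrow> open U \<and> U \<inter> A \<noteq> {} \<and> open V \<and> V \<inter> A \<noteq> {}"
  shows "\<exists>q\<in>S. \<forall>U V. (U, V) \<in> P \<longrightarrow> (\<exists>x\<in>A \<inter> U. (T ^^ q) x \<in> V)"
proof -
  obtain p where p: "bij_betw p {1..card P} P"
    using ex_bij_betw_nat_finite_1[OF P(1)] by blast
  have AX: "A \<subseteq> X"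
    using mix closedin_imp_subset unfolding mixing_set_def by blast
  let ?U = "\<lambda>i. X \<inter> fst (p i)" and ?V = "\<lambda>i. X \<inter> snd (p i)"
  have pP: "(fst (p i), snd (p i)) \<in> P" if "i \<in> {1..card P}" for i
    using that p bij_betwE by fastforce
  have "card P \<ge> 1" using P by (simp add: Suc_leI card_gt_0_iff)
  moreover have "\<forall>i\<in>{1..card P}. openin (top_of_set X) (?U i) \<and> ?U i \<inter> A \<noteq> {} \<and>
      openin (top_of_set X) (?V i) \<and> ?V i \<inter> A \<noteq> {}"
  proof
    fix i assume i: "i \<in> {1..card P}"
    show "openin (top_of_set X) (?U i) \<and> ?U i \<inter> A \<noteq> {} \<and>
      openin (top_of_set X) (?V i) \<and> ?V i \<inter> A \<noteq> {}"
      using op[OF pP[OF i]] AX by (simp add: openin_open_Int Int_assoc inf.absorb2 Int_left_commute) blast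
  qed
  ultimately have "(\<Inter>i\<in>{1..card P}. hitting_times X T (?U i \<inter> A) (?V i)) \<in> \<F>"
    using mix[unfolded mixing_set_def, THEN conjunct2, THEN conjunct2, rule_format, of "card P" ?U ?V]
    by blast
  then obtain q where q: "q \<in> S" "\<And>i. i \<in> {1..card P} \<Longrightarrow> q \<in> hitting_times X T (?U i \<inter> A) (?V i)"
    using S unfolding dual_family_def by fast
  have "\<exists>x\<in>A \<inter> U. (T ^^ q) x \<in> V" if "(U, V) \<in> P" for U V
  proof -
    have "(U, V) \<in> p ` {1..card P}" using that by (simp only: bij_betw_imp_surj_on[OF p])
    then obtain i where i: "i \<in> {1..card P}" "p i = (U, V)" by force
    show ?thesis using q(2)[OF i(1)] by (auto simp: i(2) hitting_times_def)
  qed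
  then show ?thesis using q(1) by blast
qed

text \<open>
  A member of the dual family may be finite, so it is mixing that has to provide late times. Near a
  point \<open>x\<close> of \<open>A\<close> the iterates up to time \<open>N\<close> are almost constant, hence a time at which a small
  neighbourhood of \<open>x\<close> meets the preimages of two balls far apart exceeds \<open>N\<close>. This condition is
  two further pairs in the intersection of hitting times.
\<close>

lemma mixing_set_hits_late:
  assumes mix: "mixing_set \<F> X T A" and S: "S \<in> dual_family \<F>"
    and cont: "continuous_on X T" and TX: "T ` X \<subseteq> X" and I: "finite I"
    and op: "\<And>i. i \<in> I \<Longrightarrow> open (U i) \<and> U i \<inter> A \<noteq> {} \<and> open (V i) \<and> V i \<inter> A \<noteq> {}"
  shows "\<exists>q\<in>S. q > N \<and> (\<forall>i\<in>I. \<exists>x\<in>A \<inter> U i. (T ^^ q) x \<in> V i)"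
proof -
  have AX: "A \<subseteq> X"
    using mix closedin_imp_subset unfolding mixing_set_def by blast
  obtain x y where xy: "x \<in> A" "y \<in> A" "x \<noteq> y"
    using mix unfolding mixing_set_def by blast
  define d where "d = dist x y / 4"
  have d: "d > 0" using xy by (simp add: d_def)
  have "\<exists>G. open G \<and> x \<in> G \<and> (\<forall>z\<in>X \<inter> G. dist ((T ^^ n) z) ((T ^^ n) x) < d)" for n
  proof -
    have "continuous_on X (T ^^ n)" by (rule continuous_on_funpow[OF cont TX])
    then obtain r where "r > 0" "\<And>z. z \<in> X \<Longrightarrow> dist z x < r \<Longrightarrow> dist ((T ^^ n) z) ((T ^^ n) x) < d"
      using d xy(1) AX unfolding continuous_on_iff by blast
    then show ?thesis by (intro exI[of _ "ball x r"]) (auto simp: dist_commute)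
  qed
  then obtain G where G: "\<And>n. open (G n)" "\<And>n. x \<in> G n"
    "\<And>n z. z \<in> X \<inter> G n \<Longrightarrow> dist ((T ^^ n) z) ((T ^^ n) x) < d"
    by metis
  define H where "H = (\<Inter>n\<in>{..N}. G n)"
  have H: "open H" "x \<in> H" using G by (auto simp: H_def)
  define P where "P = insert (H, ball x d) (insert (H, ball y d) ((\<lambda>i. (U i, V i)) ` I))"
  have "\<exists>q\<in>S. \<forall>U V. (U, V) \<in> P \<longrightarrow> (\<exists>x\<in>A \<inter> U. (T ^^ q) x \<in> V)"
  proof (rule mixing_set_hits_finite[OF mix S])
    have "x \<in> H \<inter> A" "x \<in> ball x d \<inter> A" "y \<in> ball y d \<inter> A" using xy d H by auto
    then show "open U \<and> U \<inter> A \<noteq> {} \<and> open V \<and> V \<inter> A \<noteq> {}" if "(U, V) \<in> P" for U V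
      using that op H(1) unfolding P_def by blast
  qed (auto simp: P_def I)
  then obtain q where q: "q \<in> S" "\<And>U V. (U, V) \<in> P \<Longrightarrow> \<exists>x\<in>A \<inter> U. (T ^^ q) x \<in> V" by blast
  have "q > N"
  proof (rule ccontr)
    assume "\<not> q > N"
    then have HG: "H \<subseteq> G q" by (auto simp: H_def)
    have "(H, ball x d) \<in> P" "(H, ball y d) \<in> P" by (simp_all add: P_def)
    then obtain z w where zw: "z \<in> A \<inter> H" "(T ^^ q) z \<in> ball x d"
      "w \<in> A \<inter> H" "(T ^^ q) w \<in> ball y d"
      using q(2) by metis
    have "dist ((T ^^ q) z) ((T ^^ q) x) < d" "dist ((T ^^ q) w) ((T ^^ q) x) < d"
      using zw HG AX by (blast intro: G(3))+
    moreover have "dist x ((T ^^ q) z) < d" "dist y ((T ^^ q) w) < d" using zw by auto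
    ultimately have "dist x y < 4 * d"
      using dist_triangle[of x y "(T ^^ q) z"] dist_triangle[of "(T ^^ q) z" y "(T ^^ q) x"]
        dist_triangle3[of "(T ^^ q) x" y "(T ^^ q) w"] by (simp add: dist_commute)
    then show False by (simp add: d_def)
  qed
  then show ?thesis using q unfolding P_def by blast
qed

section \<open>Truncation in Cantor space\<close>

definition truncate :: "nat \<Rightarrow> (nat \<Rightarrow> bool) \<Rightarrow> nat \<Rightarrow> bool" where
  "truncate n b = (\<lambda>i. i < n \<and> b i)"

lemma truncate_truncate: "m \<le> n \<Longrightarrow> truncate m (truncate n b) = truncate m b"
  by (auto simp: truncate_def fun_eq_iff)

lemma finite_range_truncate: "finite (range (truncate n))"
proof -
  have "finite {b :: nat \<Rightarrow> bool. \<forall>i. (i \<in> {..<n} \<longrightarrow> b i \<in> UNIV) \<and> (i \<notin> {..<n} \<longrightarrow> b i = False)}"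
    by (rule finite_set_of_finite_funs) auto
  moreover have "range (truncate n) \<subseteq> {b. \<forall>i. (i \<in> {..<n} \<longrightarrow> b i \<in> UNIV) \<and> (i \<notin> {..<n} \<longrightarrow> b i = False)}"
    by (auto simp: truncate_def)
  ultimately show ?thesis by (rule rev_finite_subset)
qed

lemma open_coordinate: "open {b :: nat \<Rightarrow> bool. b i = c}"
proof -
  have "open ((\<lambda>b :: nat \<Rightarrow> bool. b i) -` {c})"
    by (rule open_vimage[OF open_discrete continuous_on_product_coordinates])
  then show ?thesis by (simp add: vimage_def)
qed

lemma continuous_on_comp_truncate:
  fixes h :: "(nat \<Rightarrow> bool) \<Rightarrow> 'a::topological_space"
  shows "continuous_on UNIV (\<lambda>b. h (truncate n b))"
proof -
  have "open ((\<lambda>b. h (truncate n b)) -` B)" for B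
  proof (subst open_subopen, intro ballI)
    fix b assume b: "b \<in> (\<lambda>b. h (truncate n b)) -` B"
    define Z where "Z = (\<Inter>i\<in>{..<n}. {c :: nat \<Rightarrow> bool. c i = b i})"
    have "open Z" unfolding Z_def by (intro open_INT ballI open_coordinate) auto
    moreover have "b \<in> Z" by (simp add: Z_def)
    moreover have "truncate n c = truncate n b" if "c \<in> Z" for c
      using that by (auto simp: Z_def truncate_def fun_eq_iff)
    then have "Z \<subseteq> (\<lambda>b. h (truncate n b)) -` B" using b by (simp add: subset_iff)
    ultimately show "\<exists>Z. open Z \<and> b \<in> Z \<and> Z \<subseteq> (\<lambda>b. h (truncate n b)) -` B" by blast
  qed
  then show ?thesis by (simp add: continuous_on_open_vimage)
qed

lemma dist_cantor_point_truncate: "dist (cantor_point (truncate n b)) (cantor_point b) \<le> (1/3) ^ n"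
proof (induction n arbitrary: b)
  case 0
  show ?case
    using cantor_point_bounds[of b] cantor_point_bounds[of "truncate 0 b"] by (auto simp: dist_real_def)
next
  case (Suc n)
  let ?b = "\<lambda>i. b (Suc i)" and ?d = "if b 0 then 2/3 else 0 :: real"
  have "(\<lambda>i. truncate (Suc n) b (Suc i)) = truncate n ?b" "truncate (Suc n) b 0 = b 0"
    by (simp_all add: truncate_def)
  then have "cantor_point (truncate (Suc n) b) = ?d + cantor_point (truncate n ?b) / 3"
    using cantor_point_shift[of "truncate (Suc n) b"] by simp
  moreover have "cantor_point b = ?d + cantor_point ?b / 3" by (rule cantor_point_shift)
  ultimately have "dist (cantor_point (truncate (Suc n) b)) (cantor_point b) =
      dist (cantor_point (truncate n ?b)) (cantor_point ?b) / 3"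
    by (simp add: dist_real_def diff_divide_distrib[symmetric])
  then show ?case using Suc[of ?b] by simp
qed

text \<open>
  This is uniform continuity on Cantor space, expressed through the locally constant approximations
  of \<open>f\<close>. It is transported from the ternary model, where truncation moves points by at most \<open>(1/3) ^ n\<close>.
\<close>

lemma uniform_limit_comp_truncate:
  fixes f :: "(nat \<Rightarrow> bool) \<Rightarrow> 'a::metric_space"
  assumes "continuous_on UNIV f"
  shows "uniform_limit UNIV (\<lambda>n b. f (truncate n b)) f sequentially"
proof (rule uniform_limitI)
  fix e :: real assume e: "e > 0"
  obtain k where k: "homeomorphism UNIV cantor_set cantor_point k"
    using homeomorphism_compact[OF compact_UNIV_cantor_space continuous_on_cantor_point
          cantor_set_def[symmetric] inj_cantor_point] by blast
  have "compact cantor_set"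
    unfolding cantor_set_def
    by (rule compact_continuous_image[OF continuous_on_cantor_point compact_UNIV_cantor_space])
  moreover have "continuous_on cantor_set (f \<circ> k)"
    using k assms unfolding homeomorphism_def
    by (intro continuous_on_compose) (auto intro: continuous_on_subset)
  ultimately have "uniformly_continuous_on cantor_set (f \<circ> k)"
    by (rule compact_uniformly_continuous[rotated])
  then obtain \<delta> where \<delta>: "\<delta> > 0"
    "\<And>x y. x \<in> cantor_set \<Longrightarrow> y \<in> cantor_set \<Longrightarrow> dist x y < \<delta> \<Longrightarrow> dist (f (k x)) (f (k y)) < e"
    unfolding uniformly_continuous_on_def using e by (metis comp_apply)
  have "\<forall>\<^sub>F n in sequentially. (1/3 :: real) ^ n < \<delta>"
    by (rule order_tendstoD[OF LIMSEQ_power_zero]) (use \<delta> in auto)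
  then show "\<forall>\<^sub>F n in sequentially. \<forall>b\<in>UNIV. dist (f (truncate n b)) (f b) < e"
  proof eventually_elim
    case (elim n)
    have kc: "k (cantor_point b) = b" for b using k by (simp add: homeomorphism_def)
    show ?case
    proof
      fix b
      have "dist (cantor_point (truncate n b)) (cantor_point b) < \<delta>"
        using dist_cantor_point_truncate[of n b] elim by simp
      then show "dist (f (truncate n b)) (f b) < e"
        using \<delta>(2)[of "cantor_point (truncate n b)" "cantor_point b"] by (simp add: kc cantor_set_def)
    qed
  qed
qed

section \<open>Cantor subsets\<close>

lemma cantor_subset_range:
  fixes f :: "(nat \<Rightarrow> bool) \<Rightarrow> 'a::metric_space"
  assumes "continuous_on UNIV f" "inj f" "range f \<subseteq> A"
  shows "cantor_subset (range f) A"
proof -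
  obtain g where "homeomorphism UNIV (range f) f g"
    using homeomorphism_compact[OF compact_UNIV_cantor_space assms(1) refl assms(2)] by blast
  then have "(UNIV :: (nat \<Rightarrow> bool) set) homeomorphic range f"
    unfolding homeomorphic_def by blast
  then show ?thesis
    unfolding cantor_subset_def
    using assms(3) homeomorphic_trans[OF cantor_set_homeomorphic_cantor_space] homeomorphic_sym
    by metis
qed

text \<open>
  Cantor space is the disjoint union of two copies of itself, according to the first coordinate. So
  the block \<open>Suc n\<close> and a parametrisation of the earlier ones glue to a parametrisation of all.
\<close>

lemma injective_union_of_cantor_blocks:
  fixes \<phi> :: "nat \<times> (nat \<Rightarrow> bool) \<Rightarrow> 'a::metric_space"
  assumes cont: "\<And>j. continuous_on UNIV (\<lambda>b. \<phi> (j, b))" and inj: "inj \<phi>"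
  shows "\<exists>f :: (nat \<Rightarrow> bool) \<Rightarrow> 'a. continuous_on UNIV f \<and> inj f \<and> range f = \<phi> ` ({..n} \<times> (UNIV :: (nat \<Rightarrow> bool) set))"
proof (induction n)
  case 0
  have "inj (\<lambda>b. \<phi> (0, b))" using inj by (auto simp: inj_on_def)
  moreover have "range (\<lambda>b. \<phi> (0, b)) = \<phi> ` ({..0} \<times> UNIV)" by auto
  ultimately show ?case using cont[of 0] by blast
next
  case (Suc n)
  then obtain f :: "(nat \<Rightarrow> bool) \<Rightarrow> 'a" where f: "continuous_on UNIV f" "inj f"
    "range f = \<phi> ` ({..n} \<times> (UNIV :: (nat \<Rightarrow> bool) set))" by (elim exE conjE)
  define sh :: "(nat \<Rightarrow> bool) \<Rightarrow> nat \<Rightarrow> bool" where "sh = (\<lambda>b i. b (Suc i))"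
  define h where "h = (\<lambda>b. if b 0 then \<phi> (Suc n, sh b) else f (sh b))"
  have sh: "continuous_on S sh" for S
    unfolding sh_def
    by (intro continuous_on_coordinatewise_then_product continuous_on_subset[OF continuous_on_product_coordinates]) auto
  have "continuous_on ({b. b 0 = True} \<union> {b. b 0 = False}) h"
    unfolding h_def
  proof (rule continuous_on_cases)
    show "closed {b :: nat \<Rightarrow> bool. b 0 = True}" "closed {b :: nat \<Rightarrow> bool. b 0 = False}"
      using open_coordinate[of 0 False] open_coordinate[of 0 True]
      by (auto simp: closed_def Compl_eq)
    show "continuous_on {b. b 0 = True} (\<lambda>b. \<phi> (Suc n, sh b))"
      by (rule continuous_on_compose2[OF cont sh]) auto
    show "continuous_on {b. b 0 = False} (\<lambda>b. f (sh b))"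
      by (rule continuous_on_compose2[OF f(1) sh]) auto
  qed auto
  moreover have "{b :: nat \<Rightarrow> bool. b 0 = True} \<union> {b. b 0 = False} = UNIV" by auto
  ultimately have 1: "continuous_on UNIV h" by simp
  have ne: "\<phi> (Suc n, b) \<noteq> f c" for b c
  proof
    assume "\<phi> (Suc n, b) = f c"
    then have "\<phi> (Suc n, b) \<in> \<phi> ` ({..n} \<times> UNIV)" using f(3) by auto
    then show False using inj by (auto dest: injD)
  qed
  have 2: "inj h"
  proof (rule injI)
    fix b c assume eq: "h b = h c"
    have "b 0 = c 0 \<and> sh b = sh c"
    proof (cases "b 0"; cases "c 0")
      assume "b 0" "c 0"
      then show ?thesis using eq inj by (auto simp: h_def dest: injD)
    next
      assume "\<not> b 0" "\<not> c 0"
      then show ?thesis using eq f(2) by (auto simp: h_def dest: injD)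
    qed (use eq ne in \<open>auto simp: h_def\<close>, metis ne)
    then have "b i = c i" for i
      by (cases i) (auto simp: sh_def fun_eq_iff)
    then show "b = c" by blast
  qed
  have 3: "range h = \<phi> ` ({..Suc n} \<times> UNIV)"
  proof -
    have pre: "\<exists>c. c 0 = t \<and> sh c = b" for t b
      by (rule exI[of _ "case_nat t b"]) (simp add: sh_def)
    have "range h = range (\<lambda>b. \<phi> (Suc n, b)) \<union> range f"
    proof
      show "range h \<subseteq> range (\<lambda>b. \<phi> (Suc n, b)) \<union> range f" by (auto simp: h_def)
      show "range (\<lambda>b. \<phi> (Suc n, b)) \<union> range f \<subseteq> range h"
      proof
        fix z assume "z \<in> range (\<lambda>b. \<phi> (Suc n, b)) \<union> range f"
        then obtain b t where z: "z = (if t then \<phi> (Suc n, b) else f b)"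
          by (metis (full_types) UnE rangeE)
        obtain c where "c 0 = t" "sh c = b" using pre[of t b] by blast
        then have "h c = z" by (simp add: h_def z)
        then show "z \<in> range h" by blast
      qed
    qed
    also have "\<dots> = \<phi> ` ({..Suc n} \<times> UNIV)"
      unfolding f(3) by (auto simp: atMost_Suc)
    finally show ?thesis .
  qed
  show ?case using 1 2 3 by blast
qed

lemma infinite_Int_cantor_subset:
  assumes C: "cantor_subset C A" and U: "open U" "U \<inter> C \<noteq> {}"
  shows "infinite (U \<inter> C)"
proof -
  have "(UNIV :: (nat \<Rightarrow> bool) set) homeomorphic C"
    using C cantor_set_homeomorphic_cantor_space homeomorphic_trans homeomorphic_sym
    unfolding cantor_subset_def by blast
  then obtain f :: "(nat \<Rightarrow> bool) \<Rightarrow> 'a" and g where fg: "homeomorphism UNIV C f g"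
    unfolding homeomorphic_def by blast
  then have f: "continuous_on UNIV f" "range f = C" and gf: "\<And>b. g (f b) = b"
    unfolding homeomorphism_def by auto
  have "inj f" by (rule inj_on_inverseI[of _ g]) (rule gf)
  obtain b where b: "f b \<in> U" using U f by blast
  then obtain e where e: "e > 0" "ball (f b) e \<subseteq> U" using U(1) openE by blast
  obtain n where n: "\<And>c. dist (f (truncate n c)) (f c) < e / 2"
    using uniform_limitD[OF uniform_limit_comp_truncate[OF f(1)], of "e/2"] e
    by (metis (mono_tags, lifting) UNIV_I eventually_sequentially half_gt_zero order_refl)
  \<comment> \<open>infinitely many points of the cylinder of level \<open>n\<close> around \<open>b\<close>\<close>
  define p where "p = (\<lambda>k i. if i < n then b i else i = n + k)"
  have "truncate n (p k) = truncate n b" for k by (auto simp: truncate_def p_def)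
  then have "dist (f b) (f (p k)) < e" for k
    using n[of b] n[of "p k"] dist_triangle3[of "f b" "f (p k)" "f (truncate n b)"] by simp
  then have "f (p k) \<in> U \<inter> C" for k using e f by auto
  moreover have "inj p"
  proof (rule injI)
    fix k l assume "p k = p l"
    then have "p k (n + k) = p l (n + k)" by simp
    then show "k = l" by (simp add: p_def)
  qed
  then have "inj (\<lambda>k. f (p k))" using \<open>inj f\<close> by (auto simp: inj_on_def)
  ultimately show ?thesis
    by (meson image_subsetI infinite_iff_countable_subset)
qed

section \<open>Generic maps\<close>

text \<open>
  This is the Baire category theorem for a uniformly closed set \<open>M\<close> of maps into a compact set,
  in terms of pointwise distances: \<open>dense\<close> says that the interior of each condition
  \<open>R i\<close> is dense. In the proof the balls around \<open>g n\<close> with radius \<open>\<eta> n\<close> are nested; as each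
  step moves the map by at most half the current radius and leaves at most half of it, the distance
  from \<open>g n\<close> to a later map telescopes to \<open>\<eta> n - \<eta> (n + k)\<close>, so the limit remains in every ball.
\<close>

lemma generic_uniform_limit:
  fixes M :: "('u \<Rightarrow> 'a::metric_space) set"
  assumes X: "compact X" and MX: "\<And>f u. f \<in> M \<Longrightarrow> f u \<in> X" and ne: "M \<noteq> {}"
    and closed: "\<And>\<sigma> f. (\<And>n. \<sigma> n \<in> M) \<Longrightarrow> uniform_limit UNIV \<sigma> f sequentially \<Longrightarrow> f \<in> M"
    and I: "countable I"
    and dense: "\<And>i f \<epsilon>. i \<in> I \<Longrightarrow> f \<in> M \<Longrightarrow> \<epsilon> > 0 \<Longrightarrow>
      \<exists>g\<in>M. \<exists>\<eta>>0. (\<forall>u. dist (f u) (g u) < \<epsilon>) \<and> (\<forall>h\<in>M. (\<forall>u. dist (g u) (h u) \<le> \<eta>) \<longrightarrow> R i h)"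
  shows "\<exists>f\<in>M. \<forall>i\<in>I. R i f"
proof (cases "I = {}")
  case True
  then show ?thesis using ne by blast
next
  case False
  define r where "r = from_nat_into I"
  have r: "range r = I" unfolding r_def using False I by (rule range_from_nat_into)
  define P where "P = (\<lambda>n (g, \<eta>). g \<in> M \<and> 0 < \<eta> \<and> \<eta> \<le> (1/2::real)^n \<and>
      (\<forall>h\<in>M. (\<forall>u. dist (g u) (h u) \<le> \<eta>) \<longrightarrow> R (r n) h))"
  define Q where "Q = (\<lambda>(g :: 'u \<Rightarrow> 'a, \<eta>) (g', \<eta>' :: real). (\<forall>u. dist (g u) (g' u) \<le> \<eta>/2) \<and> \<eta>' \<le> \<eta>/2)"
  have step: "\<exists>y. P n y \<and> Q (f, \<epsilon>) y" if "f \<in> M" "\<epsilon> > 0" for n f \<epsilon>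
  proof -
    have "r n \<in> I" "\<epsilon>/2 > 0" using r that by auto
    from dense[OF this(1) that(1) this(2)] obtain g \<eta> where g: "g \<in> M" "\<eta> > 0"
      "\<And>u. dist (f u) (g u) < \<epsilon>/2" "\<And>h. h \<in> M \<Longrightarrow> (\<forall>u. dist (g u) (h u) \<le> \<eta>) \<Longrightarrow> R (r n) h"
      by metis
    let ?\<eta> = "min \<eta> (min (\<epsilon>/2) ((1/2)^n))"
    have "P n (g, ?\<eta>) \<and> Q (f, \<epsilon>) (g, ?\<eta>)"
      using g that by (auto simp: P_def Q_def less_imp_le)
    then show ?thesis by blast
  qed
  obtain f0 where "f0 \<in> M" using ne by blast
  then have "\<exists>x. P 0 x" using step[of f0 1 0] by auto
  moreover have "\<exists>y. P (Suc n) y \<and> Q x y" if "P n x" for x n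
    using step[of "fst x" "snd x" "Suc n"] that by (auto simp: P_def)
  ultimately obtain s where s: "\<And>n. P n (s n)" "\<And>n. Q (s n) (s (Suc n))"
    using dependent_nat_choice[of P "\<lambda>_. Q"] by metis
  define g where "g = (\<lambda>n. fst (s n))"
  define \<eta> where "\<eta> = (\<lambda>n. snd (s n))"
  have sn: "s n = (g n, \<eta> n)" for n by (simp add: g_def \<eta>_def)
  have g: "g n \<in> M" "0 < \<eta> n" "\<eta> n \<le> (1/2)^n"
    "h \<in> M \<Longrightarrow> (\<forall>u. dist (g n u) (h u) \<le> \<eta> n) \<Longrightarrow> R (r n) h"
    "dist (g n u) (g (Suc n) u) \<le> \<eta> n / 2" "\<eta> (Suc n) \<le> \<eta> n / 2" for n h u
    using s(1)[of n] s(2)[of n] by (auto simp: P_def Q_def sn)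
  have tele: "dist (g n u) (g (n + k) u) \<le> \<eta> n - \<eta> (n + k)" for n k u
  proof (induction k)
    case (Suc k)
    then show ?case using g(5)[of "n+k" u] g(6)[of "n+k"]
        dist_triangle[of "g n u" "g (n + Suc k) u" "g (n + k) u"] by simp
  qed simp
  have close: "dist (g n u) (g m u) \<le> \<eta> n" if "n \<le> m" for n m u
    using tele[of n u "m - n"] g(2)[of m] that by simp
  have eta: "\<eta> \<longlonglongrightarrow> 0"
    by (rule tendsto_sandwich[OF _ _ tendsto_const LIMSEQ_power_zero[of "1/2::real"]])
      (use g(2,3) in \<open>auto intro!: always_eventually less_imp_le\<close>)
  have "\<exists>l. (\<lambda>n. g n u) \<longlonglongrightarrow> l" for u
  proof -
    have "Cauchy (\<lambda>n. g n u)"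
    proof (rule metric_CauchyI)
      fix e :: real assume "e > 0"
      then obtain N where N: "\<eta> N < e / 2"
        using order_tendstoD(2)[OF eta, of "e/2"] eventually_sequentially by auto
      have "dist (g m u) (g n u) < e" if "m \<ge> N" "n \<ge> N" for m n
        using close[OF that(1), of u] close[OF that(2), of u] N
          dist_triangle3[of "g m u" "g n u" "g N u"] by linarith
      then show "\<exists>N. \<forall>m\<ge>N. \<forall>n\<ge>N. dist (g m u) (g n u) < e" by blast
    qed
    moreover have "\<forall>n. g n u \<in> X" using MX[OF g(1)] by blast
    ultimately show ?thesis using completeE[OF compact_imp_complete[OF X], of "\<lambda>n. g n u"] by blast
  qed
  then obtain f where f: "\<And>u. (\<lambda>n. g n u) \<longlonglongrightarrow> f u" by metis
  have fc: "dist (g n u) (f u) \<le> \<eta> n" for n u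
  proof (rule tendsto_upperbound)
    show "(\<lambda>m. dist (g n u) (g m u)) \<longlonglongrightarrow> dist (g n u) (f u)" by (intro tendsto_intros f)
    show "\<forall>\<^sub>F m in sequentially. dist (g n u) (g m u) \<le> \<eta> n"
      using eventually_ge_at_top[of n] by eventually_elim (rule close)
  qed simp
  have "uniform_limit UNIV g f sequentially"
  proof (rule uniform_limitI)
    fix e :: real assume "e > 0"
    then have "\<forall>\<^sub>F n in sequentially. \<eta> n < e" by (rule order_tendstoD(2)[OF eta])
    then show "\<forall>\<^sub>F n in sequentially. \<forall>u\<in>UNIV. dist (g n u) (f u) < e"
      by eventually_elim (use fc in \<open>meson le_less_trans\<close>)
  qed
  then have fM: "f \<in> M" by (rule closed[OF g(1)])
  have "R (r n) f" for n using g(4)[OF fM] fc by blast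
  then show ?thesis using fM r by blast
qed

lemma compact_countable_dense:
  fixes A :: "'a::metric_space set"
  assumes "compact A"
  shows "\<exists>D. countable D \<and> D \<subseteq> A \<and> A \<subseteq> closure D"
proof -
  have "\<exists>k. finite k \<and> k \<subseteq> A \<and> A \<subseteq> (\<Union>x\<in>k. ball x (1 / real (Suc n)))" for n
  proof -
    have "A \<subseteq> (\<Union>x\<in>A. ball x (1 / real (Suc n)))" by auto
    then obtain k where "k \<subseteq> A" "finite k" "A \<subseteq> (\<Union>x\<in>k. ball x (1 / real (Suc n)))"
      using compactE_image[OF assms, of A "\<lambda>x. ball x (1 / real (Suc n))"] by blast
    then show ?thesis by blast
  qed
  then obtain k where k: "\<And>n. finite (k n)" "\<And>n. k n \<subseteq> A"
    "\<And>n. A \<subseteq> (\<Union>x\<in>k n. ball x (1 / real (Suc n)))" by metis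
  have "A \<subseteq> closure (\<Union>n. k n)"
  proof
    fix a assume a: "a \<in> A"
    show "a \<in> closure (\<Union>n. k n)"
      unfolding closure_approachable
    proof (intro allI impI)
      fix e :: real assume "e > 0"
      then obtain n where "1 / real (Suc n) < e" using nat_approx_posE by blast
      moreover obtain x where "x \<in> k n" "dist x a < 1 / real (Suc n)" using k(3)[of n] a by auto
      ultimately show "\<exists>y\<in>\<Union>n. k n. dist y a < e" by (meson UN_I UNIV_I less_trans)
    qed
  qed
  then show ?thesis
    using k by (intro exI[of _ "\<Union>n. k n"]) (auto intro: countable_finite)
qed

text \<open>
  The sets \<open>W j\<close> are small balls around the points of a countable dense set. Passing to closures in
  the conclusion matters because uniform limits preserve only membership in closed sets.
\<close>

lemma compact_countable_open_pi_base:
  fixes A :: "'a::metric_space set"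
  assumes "compact A" "A \<noteq> {}"
  shows "\<exists>W :: nat \<Rightarrow> 'a set. (\<forall>j. open (W j) \<and> W j \<inter> A \<noteq> {}) \<and>
    (\<forall>U. open U \<and> U \<inter> A \<noteq> {} \<longrightarrow> (\<exists>j. closure (W j) \<subseteq> U))"
proof -
  obtain D where D: "countable D" "D \<subseteq> A" "A \<subseteq> closure D"
    using compact_countable_dense[OF assms(1)] by blast
  have Dne: "D \<noteq> {}" using D(3) assms(2) by auto
  define B where "B = (\<lambda>(d, n). ball d (1 / real (Suc n))) ` (D \<times> UNIV)"
  have "countable B" "B \<noteq> {}" using D(1) Dne by (auto simp: B_def)
  then have W: "range (from_nat_into B) = B" by (simp add: range_from_nat_into)
  have "open b \<and> b \<inter> A \<noteq> {}" if b: "b \<in> B" for b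
  proof -
    obtain p where p: "p \<in> D \<times> UNIV" "b = (\<lambda>(d, n). ball d (1 / real (Suc n))) p"
      using b unfolding B_def by (rule imageE)
    then obtain d n where dn: "b = ball d (1 / real (Suc n))" "d \<in> D"
      by (cases p) (simp del: of_nat_Suc)
    then have "d \<in> b \<inter> A" using D(2) by auto
    then show ?thesis using dn(1) by auto
  qed
  moreover have "\<exists>b\<in>B. closure b \<subseteq> U" if U: "open U" "U \<inter> A \<noteq> {}" for U
  proof -
    obtain a where a: "a \<in> U" "a \<in> A" using U by blast
    obtain e where e: "e > 0" "ball a e \<subseteq> U" using U a openE by blast
    then obtain n where n: "1 / real (Suc n) < e / 2" using nat_approx_posE[of "e/2"] by auto
    obtain d where d: "d \<in> D" "dist d a < 1 / real (Suc n)"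
      using D(3) a(2) closure_approachable[of a D] by (meson divide_pos_pos of_nat_0_less_iff subsetD zero_less_Suc zero_less_one)
    have "cball d (1 / real (Suc n)) \<subseteq> ball a e"
    proof
      fix z assume "z \<in> cball d (1 / real (Suc n))"
      then show "z \<in> ball a e" using d(2) n dist_triangle[of a z d] by (auto simp: dist_commute)
    qed
    then have "closure (ball d (1 / real (Suc n))) \<subseteq> U"
      using e(2) closure_minimal[OF ball_subset_cball closed_cball] by blast
    moreover have "ball d (1 / real (Suc n)) \<in> B" using d(1) unfolding B_def by auto
    ultimately show ?thesis by blast
  qed
  ultimately show ?thesis
    using W by (intro exI[of _ "from_nat_into B"]) (metis rangeE rangeI)
qed

section \<open>Maps steered by a set of times\<close>

text \<open>
  The map \<open>s\<close> is evaluated at truncated sequences only, so it is a choice of a target for each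
  cylinder of level \<open>m\<close>. Using the one parameter \<open>m\<close> for the number of blocks, the level of the
  cylinders and the accuracy costs nothing, since a choice of targets can be refined to higher levels.
\<close>

definition steers :: "nat set \<Rightarrow> ('a::metric_space \<Rightarrow> 'a) \<Rightarrow> 'a set \<Rightarrow> (nat \<times> (nat \<Rightarrow> bool) \<Rightarrow> 'a) \<Rightarrow> bool" where
  "steers S T A \<phi> \<longleftrightarrow> (\<forall>m N s. range s \<subseteq> A \<longrightarrow>
     (\<exists>q\<in>S. q > N \<and> (\<forall>j\<le>m. \<forall>b. dist ((T ^^ q) (\<phi> (j, b))) (s (j, truncate m b)) < 1 / real (Suc m))))"

text \<open>
  The constraint involves the closure so that \<open>block_maps A W\<close> is closed under uniform limits, while
  its points can be moved slightly into the open set \<open>W j\<close>.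
\<close>

definition block_maps :: "'a::metric_space set \<Rightarrow> (nat \<Rightarrow> 'a set) \<Rightarrow> (nat \<times> (nat \<Rightarrow> bool) \<Rightarrow> 'a) set" where
  "block_maps A W = {\<phi>. \<forall>j. continuous_on UNIV (\<lambda>b. \<phi> (j, b)) \<and> (\<forall>b. \<phi> (j, b) \<in> closure (A \<inter> W j))}"

text \<open>
  The perturbation \<open>g\<close> is constant on cylinders of a level \<open>n\<close> so high that \<open>f\<close> varies little
  on them; its finitely many values come from mixing, applied to neighbourhoods of the values of \<open>f\<close>.
  The blocks beyond \<open>m\<close> are kept. As only finitely many values matter, a single radius
  \<open>\<eta>\<close> protects the time \<open>q\<close> against further perturbation.
\<close>

lemma block_maps_perturb:
  assumes mix: "mixing_set \<F> X T A" and S: "S \<in> dual_family \<F>"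
    and cont: "continuous_on X T" and TX: "T ` X \<subseteq> X"
    and A: "closed A"
    and W: "\<And>j. open (W j)"
    and s: "\<And>j b. j \<le> m \<Longrightarrow> s (j, truncate m b) \<in> A"
    and f: "f \<in> block_maps A W" and \<epsilon>: "\<epsilon> > 0"
  shows "\<exists>g\<in>block_maps A W. \<exists>\<eta>>0. (\<forall>u. dist (f u) (g u) < \<epsilon>) \<and>
    (\<forall>h\<in>block_maps A W. (\<forall>u. dist (g u) (h u) \<le> \<eta>) \<longrightarrow>
      (\<exists>q\<in>S. q > m \<and> (\<forall>j\<le>m. \<forall>b. dist ((T ^^ q) (h (j, b))) (s (j, truncate m b)) < 1 / real (Suc m))))"
proof -
  have AX: "A \<subseteq> X"
    using mix closedin_imp_subset unfolding mixing_set_def by blast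
  have fcont: "continuous_on UNIV (\<lambda>b. f (j, b))" and fW: "f (j, b) \<in> closure (A \<inter> W j)" for j b
    using f by (auto simp: block_maps_def)
  have "\<forall>\<^sub>F n in sequentially. \<forall>j\<in>{..m}. \<forall>b. dist (f (j, truncate n b)) (f (j, b)) < \<epsilon> / 2"
    using uniform_limitD[OF uniform_limit_comp_truncate[OF fcont], of "\<epsilon>/2"] \<epsilon>
    by (intro eventually_ball_finite) auto
  then obtain n where n: "n \<ge> m" "\<And>j b. j \<le> m \<Longrightarrow> dist (f (j, truncate n b)) (f (j, b)) < \<epsilon> / 2"
    using eventually_conj[OF eventually_ge_at_top[of m]] unfolding eventually_sequentially
    by (metis (no_types, lifting) atMost_iff nle_le)
  define I where "I = {..m} \<times> range (truncate n)"
  have I: "finite I" "I \<noteq> {}" by (auto simp: I_def finite_range_truncate)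
  define U where "U = (\<lambda>v. ball (f v) (\<epsilon>/2) \<inter> W (fst v))"
  define V where "V = (\<lambda>v. ball (s (fst v, truncate m (snd v))) (1 / real (Suc m)))"
  have "\<exists>q\<in>S. q > m \<and> (\<forall>v\<in>I. \<exists>x\<in>A \<inter> U v. (T ^^ q) x \<in> V v)"
  proof (rule mixing_set_hits_late[OF mix S cont TX I(1)])
    fix v assume v: "v \<in> I"
    have "f v \<in> closure (A \<inter> W (fst v))" using fW[of "fst v" "snd v"] by simp
    then obtain x where "x \<in> A \<inter> W (fst v)" "dist x (f v) < \<epsilon>/2"
      using \<epsilon> unfolding closure_approachable by (meson half_gt_zero)
    then have "x \<in> U v \<inter> A" by (simp add: U_def dist_commute)
    moreover have "s (fst v, truncate m (snd v)) \<in> V v \<inter> A"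
      using s[of "fst v"] v by (auto simp: V_def I_def)
    moreover have "open (U v)" "open (V v)" using W by (auto simp: U_def V_def)
    ultimately show "open (U v) \<and> U v \<inter> A \<noteq> {} \<and> open (V v) \<and> V v \<inter> A \<noteq> {}" by blast
  qed
  then obtain q x where q: "q \<in> S" "q > m"
    and x: "\<And>v. v \<in> I \<Longrightarrow> x v \<in> A \<inter> U v" "\<And>v. v \<in> I \<Longrightarrow> (T ^^ q) (x v) \<in> V v" by metis
  define g where "g = (\<lambda>(j, b). if j \<le> m then x (j, truncate n b) else f (j, b))"
  have vI: "(j, truncate n b) \<in> I" if "j \<le> m" for j b using that by (auto simp: I_def)
  have gM: "g \<in> block_maps A W"
  proof -
    have "continuous_on UNIV (\<lambda>b. g (j, b))" for j
      using fcont[of j] continuous_on_comp_truncate[of "\<lambda>c. x (j, c)" n]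
      by (cases "j \<le> m") (simp_all add: g_def)
    moreover have "g (j, b) \<in> closure (A \<inter> W j)" for j b
    proof (cases "j \<le> m")
      case True
      have "x (j, truncate n b) \<in> A \<inter> W j" using x(1)[OF vI[OF True]] by (auto simp: U_def)
      then show ?thesis using True closure_subset[of "A \<inter> W j"] by (auto simp: g_def)
    qed (use fW in \<open>simp add: g_def\<close>)
    ultimately show ?thesis by (auto simp: block_maps_def)
  qed
  have fg: "dist (f u) (g u) < \<epsilon>" for u
  proof -
    obtain j b where u: "u = (j, b)" by (cases u)
    show ?thesis
    proof (cases "j \<le> m")
      case True
      have "dist (f (j, truncate n b)) (x (j, truncate n b)) < \<epsilon>/2"
        using x(1)[OF vI[OF True]] by (auto simp: U_def)
      then show ?thesis
        using n(2)[OF True, of b] True dist_triangle3[of "f (j, b)" "x (j, truncate n b)" "f (j, truncate n b)"]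
        by (simp add: u g_def)
    qed (use \<epsilon> in \<open>simp add: u g_def\<close>)
  qed
  have "\<exists>\<eta>>0. \<forall>z\<in>X. dist (x v) z \<le> \<eta> \<longrightarrow> (T ^^ q) z \<in> V v" if v: "v \<in> I" for v
  proof -
    have "continuous_on X (T ^^ q)" "x v \<in> X"
      using continuous_on_funpow[OF cont TX] x(1)[OF v] AX by auto
    moreover obtain e where e: "e > 0" "ball ((T ^^ q) (x v)) e \<subseteq> V v"
    proof (rule openE[OF _ x(2)[OF v]])
      show "open (V v)" by (simp add: V_def)
    qed
    ultimately obtain d where d: "d > 0" "\<And>z. z \<in> X \<Longrightarrow> dist z (x v) < d \<Longrightarrow> dist ((T ^^ q) z) ((T ^^ q) (x v)) < e"
      unfolding continuous_on_iff by blast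
    have "(T ^^ q) z \<in> V v" if "z \<in> X" "dist (x v) z \<le> d/2" for z
      using d(2)[of z] d(1) that e(2) by (auto simp: dist_commute subset_iff)
    then show ?thesis using d(1) by (intro exI[of _ "d/2"]) auto
  qed
  then obtain \<eta> where \<eta>: "\<And>v. v \<in> I \<Longrightarrow> \<eta> v > 0"
    "\<And>v z. v \<in> I \<Longrightarrow> z \<in> X \<Longrightarrow> dist (x v) z \<le> \<eta> v \<Longrightarrow> (T ^^ q) z \<in> V v" by metis
  have "dist ((T ^^ q) (h (j, b))) (s (j, truncate m b)) < 1 / real (Suc m)"
    if h: "h \<in> block_maps A W" "\<And>u. dist (g u) (h u) \<le> Min (\<eta> ` I)" and j: "j \<le> m" for h j b
  proof -
    have "closure (A \<inter> W j) \<subseteq> A" by (rule closure_minimal[OF _ A]) auto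
    then have "h (j, b) \<in> X" using h(1) AX unfolding block_maps_def by blast
    moreover have "Min (\<eta> ` I) \<le> \<eta> (j, truncate n b)" using I vI[OF j] by auto
    then have "dist (x (j, truncate n b)) (h (j, b)) \<le> \<eta> (j, truncate n b)"
      using h(2)[of "(j, b)"] j by (simp add: g_def)
    ultimately have "(T ^^ q) (h (j, b)) \<in> V (j, truncate n b)" using \<eta>(2) vI[OF j] by blast
    then show ?thesis by (simp add: V_def truncate_truncate[OF n(1)] dist_commute)
  qed
  moreover have "Min (\<eta> ` I) > 0" using I \<eta>(1) by auto
  ultimately show ?thesis using gM fg q by blast
qed

text \<open>
  Genericity handles targets in the countable dense set \<open>D\<close>; arbitrary targets, levels and lower
  bounds for the time are then reached by approximating the targets and enlarging the parameter.
\<close>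

lemma exists_steered_map:
  assumes mix: "mixing_set \<F> X T A" and S: "S \<in> dual_family \<F>"
    and cont: "continuous_on X T" and TX: "T ` X \<subseteq> X"
    and A: "compact A" and W: "\<And>j. open (W j)" "\<And>j. W j \<inter> A \<noteq> {}"
  shows "\<exists>\<phi>\<in>block_maps A W. steers S T A \<phi>"
proof -
  obtain D where D: "countable D" "D \<subseteq> A" "A \<subseteq> closure D"
    using compact_countable_dense[OF A] by blast
  have clA: "closure (A \<inter> W j) \<subseteq> A" for j
    by (rule closure_minimal) (auto simp: compact_imp_closed[OF A])
  define I where "I = Sigma UNIV (\<lambda>m. PiE ({..m} \<times> range (truncate m)) (\<lambda>_. D))"
  have "countable I"
    unfolding I_def using D(1) by (intro countable_SIGMA countable_PiE) (auto simp: finite_range_truncate)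
  have "\<exists>\<phi>\<in>block_maps A W. \<forall>i\<in>I. case i of (m, s) \<Rightarrow> (\<exists>q\<in>S. q > m \<and>
      (\<forall>j\<le>m. \<forall>b. dist ((T ^^ q) (\<phi> (j, b))) (s (j, truncate m b)) < 1 / real (Suc m)))"
  proof (rule generic_uniform_limit[OF A _ _ _ \<open>countable I\<close>])
    show "f u \<in> A" if "f \<in> block_maps A W" for f u
      using that clA[of "fst u"] by (cases u) (auto simp: block_maps_def)
    have "\<exists>a. a \<in> closure (A \<inter> W j)" for j using W(2)[of j] closure_subset[of "A \<inter> W j"] by blast
    then obtain a where "\<And>j. a j \<in> closure (A \<inter> W j)" by metis
    then have "(\<lambda>(j, b). a j) \<in> block_maps A W" by (simp add: block_maps_def)
    then show "block_maps A W \<noteq> {}" by blast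
  next
    fix \<sigma> f assume \<sigma>: "\<And>n. \<sigma> n \<in> block_maps A W" and lim: "uniform_limit UNIV \<sigma> f sequentially"
    have "continuous_on UNIV (\<lambda>b. f (j, b))" for j
    proof (rule uniform_limit_theorem)
      show "uniform_limit UNIV (\<lambda>n b. \<sigma> n (j, b)) (\<lambda>b. f (j, b)) sequentially"
        by (rule uniform_limit_compose'[OF lim]) simp
      show "\<forall>\<^sub>F n in sequentially. continuous_on UNIV (\<lambda>b. \<sigma> n (j, b))"
        using \<sigma> by (auto simp: block_maps_def)
    qed auto
    moreover have "f (j, b) \<in> closure (A \<inter> W j)" for j b
    proof (rule closed_sequentially[OF closed_closure])
      show "(\<lambda>n. \<sigma> n (j, b)) \<longlonglongrightarrow> f (j, b)" using tendsto_uniform_limitI[OF lim] by blast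
      show "\<sigma> n (j, b) \<in> closure (A \<inter> W j)" for n using \<sigma>[of n] by (auto simp: block_maps_def)
    qed
    ultimately show "f \<in> block_maps A W" by (auto simp: block_maps_def)
  next
    fix i f and \<epsilon> :: real assume i: "i \<in> I" and f: "f \<in> block_maps A W" and \<epsilon>: "\<epsilon> > 0"
    obtain m s where ms: "i = (m, s)" by (cases i)
    have "s (j, truncate m b) \<in> A" if "j \<le> m" for j b
      using i that D(2) by (auto simp: ms I_def PiE_def Pi_def)
    from block_maps_perturb[OF mix S cont TX compact_imp_closed[OF A], of W m s, OF W(1) this f \<epsilon>]
    show "\<exists>g\<in>block_maps A W. \<exists>\<eta>>0. (\<forall>u. dist (f u) (g u) < \<epsilon>) \<and>
      (\<forall>h\<in>block_maps A W. (\<forall>u. dist (g u) (h u) \<le> \<eta>) \<longrightarrow> (case i of (m, s) \<Rightarrow> (\<exists>q\<in>S. q > m \<and>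
      (\<forall>j\<le>m. \<forall>b. dist ((T ^^ q) (h (j, b))) (s (j, truncate m b)) < 1 / real (Suc m)))))"
      by (simp add: ms)
  qed
  then obtain \<phi> where \<phi>M: "\<phi> \<in> block_maps A W"
    and \<phi>I: "\<forall>i\<in>I. case i of (m, s) \<Rightarrow> (\<exists>q\<in>S. q > m \<and>
      (\<forall>j\<le>m. \<forall>b. dist ((T ^^ q) (\<phi> (j, b))) (s (j, truncate m b)) < 1 / real (Suc m)))"
    by (elim bexE)
  have \<phi>: "\<exists>q\<in>S. q > m \<and>
      (\<forall>j\<le>m. \<forall>b. dist ((T ^^ q) (\<phi> (j, b))) (s (j, truncate m b)) < 1 / real (Suc m))"
    if "s \<in> PiE ({..m} \<times> range (truncate m)) (\<lambda>_. D)" for m s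
  proof -
    have "(m, s) \<in> I" using that by (simp add: I_def)
    then show ?thesis using \<phi>I by fastforce
  qed
  have "\<exists>q\<in>S. q > N \<and> (\<forall>j\<le>m. \<forall>b. dist ((T ^^ q) (\<phi> (j, b))) (s (j, truncate m b)) < 1 / real (Suc m))"
    if s: "range s \<subseteq> A" for m N s
  proof -
    \<comment> \<open>large enough that the error of steering and the error of replacing a target by a point of
      \<open>D\<close>, both at most \<open>1 / Suc M\<close>, add up to at most \<open>1 / Suc m\<close>\<close>
    define M where "M = 2 * m + 1 + N"
    define \<delta> where "\<delta> = 1 / real (Suc M)"
    have M: "m \<le> M" "N \<le> M" by (auto simp: M_def)
    have \<delta>: "\<delta> > 0" "\<delta> + \<delta> \<le> 1 / real (Suc m)" by (auto simp: \<delta>_def M_def field_simps)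
    have "\<exists>d\<in>D. dist d (s v) < \<delta>" for v
    proof -
      have "s v \<in> closure D" using s D(3) by auto
      then show ?thesis using \<delta>(1) by (simp add: closure_approachable)
    qed
    then obtain d where d: "\<And>v. d v \<in> D" "\<And>v. dist (d v) (s v) < \<delta>" by metis
    let ?t = "restrict (\<lambda>(j, c). d (j, truncate m c)) ({..M} \<times> range (truncate M))"
    have "?t \<in> PiE ({..M} \<times> range (truncate M)) (\<lambda>_. D)" using d(1) by auto
    from \<phi>[OF this] obtain q where q: "q \<in> S" "q > M"
      "\<And>j b. j \<le> M \<Longrightarrow> dist ((T ^^ q) (\<phi> (j, b))) (?t (j, truncate M b)) < \<delta>"
      unfolding \<delta>_def by blast
    have "dist ((T ^^ q) (\<phi> (j, b))) (s (j, truncate m b)) < 1 / real (Suc m)" if "j \<le> m" for j b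
      using q(3)[of j b] d(2)[of "(j, truncate m b)"] \<delta>(2) that M
        dist_triangle[of "(T ^^ q) (\<phi> (j, b))" "s (j, truncate m b)" "d (j, truncate m b)"]
      by (simp add: truncate_truncate)
    then show ?thesis using q M by (intro bexI[of _ q]) auto
  qed
  then show ?thesis using \<phi>M unfolding steers_def by blast
qed

text \<open>
  Two points with the same image would be moved by the same iterate close to two different targets.
\<close>

lemma steers_inj:
  assumes st: "steers S T A \<phi>" and xy: "x \<in> A" "y \<in> A" "x \<noteq> y"
  shows "inj \<phi>"
proof (rule injI, rule ccontr)
  fix u v assume eq: "\<phi> u = \<phi> v" and ne: "u \<noteq> v"
  obtain j b k c where uv: "u = (j, b)" "v = (k, c)" by (cases u; cases v)
  obtain i where i: "j \<noteq> k \<or> b i \<noteq> c i" using ne uv by auto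
  obtain l where l: "1 / real (Suc l) < dist x y / 2"
    using nat_approx_posE[of "dist x y / 2"] xy by auto
  define m where "m = j + k + Suc i + l"
  have sep: "(j, truncate m b) \<noteq> (k, truncate m c)"
  proof
    assume eq: "(j, truncate m b) = (k, truncate m c)"
    then have "truncate m b i = truncate m c i" by simp
    then show False using i eq by (simp add: truncate_def m_def)
  qed
  define s where "s = (\<lambda>w. if w = (j, truncate m b) then x else y)"
  have "range s \<subseteq> A" using xy by (auto simp: s_def)
  then obtain q where q: "\<forall>j\<le>m. \<forall>b. dist ((T ^^ q) (\<phi> (j, b))) (s (j, truncate m b)) < 1 / real (Suc m)"
    using st unfolding steers_def by blast
  have "dist ((T ^^ q) (\<phi> u)) x < 1 / real (Suc m)"
    using q[rule_format, of j b] by (simp add: s_def uv m_def)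
  moreover have "dist ((T ^^ q) (\<phi> v)) y < 1 / real (Suc m)"
  proof -
    have "s (k, truncate m c) = y" using sep unfolding s_def by metis
    then show ?thesis using q[rule_format, of k c] by (simp add: uv m_def)
  qed
  then have "dist ((T ^^ q) (\<phi> u)) y < 1 / real (Suc m)" by (simp only: eq)
  moreover have "1 / real (Suc m) \<le> 1 / real (Suc l)" by (simp add: m_def field_simps)
  ultimately show False using l dist_triangle3[of x y "(T ^^ q) (\<phi> u)"] by linarith
qed

lemma steers_sequence:
  assumes st: "steers S T A \<phi>" and s: "\<And>m. range (s m) \<subseteq> A"
  shows "\<exists>q. subsequence_of q S \<and>
    (\<forall>m. \<forall>j\<le>m. \<forall>b. dist ((T ^^ q m) (\<phi> (j, b))) (s m (j, truncate m b)) < 1 / real (Suc m))"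
proof -
  define P where "P = (\<lambda>m q. q \<in> S \<and>
    (\<forall>j\<le>m. \<forall>b. dist ((T ^^ q) (\<phi> (j, b))) (s m (j, truncate m b)) < 1 / real (Suc m)))"
  have "\<exists>q. P m q \<and> N < q" for m N
    using st s[of m] unfolding steers_def P_def by blast
  then obtain q where q: "\<And>m. P m (q m)" "\<And>m. q m < q (Suc m)"
    using dependent_nat_choice[of P "\<lambda>_ x y. x < y"] by metis
  then have "subsequence_of q S"
    unfolding subsequence_of_def strict_mono_Suc_iff P_def by auto
  then show ?thesis using q(1) unfolding P_def by blast
qed

lemma steers_uniform_approximation:
  assumes st: "steers S T A \<phi>" and cont: "\<And>j. continuous_on UNIV (\<lambda>b. \<phi> (j, b))"
    and a: "a \<in> A" and C: "C = \<phi> ` ({..n} \<times> UNIV)"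
    and g: "continuous_on C g" "g ` C \<subseteq> A"
  shows "\<exists>q. subsequence_of q S \<and> uniform_limit C (\<lambda>i x. (T ^^ q i) x) g sequentially"
proof -
  define s where "s = (\<lambda>(j, c). if j \<le> n then g (\<phi> (j, c)) else a)"
  have "range s \<subseteq> A" using a g(2) by (fastforce simp: s_def C)
  from steers_sequence[OF st, of "\<lambda>_. s", OF this]
  obtain q where q: "subsequence_of q S"
    "\<And>m j b. j \<le> m \<Longrightarrow> dist ((T ^^ q m) (\<phi> (j, b))) (s (j, truncate m b)) < 1 / real (Suc m)" by blast
  have "uniform_limit C (\<lambda>i x. (T ^^ q i) x) g sequentially"
  proof (rule uniform_limitI)
    fix e :: real assume e: "e > 0"
    have "continuous_on UNIV (\<lambda>b. g (\<phi> (j, b)))" if "j \<le> n" for j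
      by (rule continuous_on_compose2[OF g(1) cont]) (use that in \<open>auto simp: C\<close>)
    then have "\<forall>\<^sub>F m in sequentially. \<forall>j\<in>{..n}. \<forall>b. dist (g (\<phi> (j, truncate m b))) (g (\<phi> (j, b))) < e / 2"
      using uniform_limitD[OF uniform_limit_comp_truncate, of _ "e/2"] e
      by (intro eventually_ball_finite) auto
    moreover have "\<forall>\<^sub>F m in sequentially. 1 / real (Suc m) < e / 2"
      by (rule order_tendstoD(2)[OF lim_inverse_n'[THEN LIMSEQ_Suc]]) (use e in simp)
    moreover have "\<forall>\<^sub>F m in sequentially. n \<le> m" by (rule eventually_ge_at_top)
    ultimately show "\<forall>\<^sub>F m in sequentially. \<forall>x\<in>C. dist ((T ^^ q m) x) (g x) < e"
    proof eventually_elim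
      case (elim m)
      have "dist ((T ^^ q m) (\<phi> (j, b))) (g (\<phi> (j, b))) < e" if "j \<le> n" for j b
      proof -
        have "dist ((T ^^ q m) (\<phi> (j, b))) (g (\<phi> (j, truncate m b))) < e/2"
          using q(2)[of j m b] that elim(2,3) by (simp add: s_def)
        moreover have "dist (g (\<phi> (j, truncate m b))) (g (\<phi> (j, b))) < e/2" using elim(1) that by auto
        ultimately show ?thesis
          using dist_triangle[of "(T ^^ q m) (\<phi> (j, b))" "g (\<phi> (j, b))" "g (\<phi> (j, truncate m b))"]
          by linarith
      qed
      then show ?case by (auto simp: C)
    qed
  qed
  then show ?thesis using q(1) by blast
qed

text \<open>
  The target of a cylinder that meets \<open>E\<close> is the value of \<open>g\<close> at some point of \<open>E\<close> in it. As the
  level grows, the cylinders around a point \<open>x\<close> of \<open>E\<close> shrink, so these points of \<open>E\<close> converge to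
  \<open>x\<close> and continuity of \<open>g\<close> on \<open>E\<close> suffices.
\<close>

lemma steers_pointwise_approximation:
  assumes st: "steers S T A \<phi>" and cont: "\<And>j. continuous_on UNIV (\<lambda>b. \<phi> (j, b))"
    and a: "a \<in> A" and E: "E \<subseteq> range \<phi>"
    and g: "continuous_on E g" "g ` E \<subseteq> A"
  shows "\<exists>q. subsequence_of q S \<and> (\<forall>x\<in>E. (\<lambda>i. (T ^^ q i) x) \<longlonglongrightarrow> g x)"
proof -
  \<comment> \<open>\<open>ok m j c b\<close>: the point with coordinates \<open>(j, b)\<close> is in \<open>E\<close> and in the cylinder \<open>c\<close> of level \<open>m\<close>\<close>
  define ok where "ok = (\<lambda>m j c b. \<phi> (j, b) \<in> E \<and> truncate m b = c)"
  define s where "s = (\<lambda>m (j, c). if \<exists>b. ok m j c b then g (\<phi> (j, SOME b. ok m j c b)) else a)"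
  have "range (s m) \<subseteq> A" for m
  proof -
    have "s m (j, c) \<in> A" for j c
    proof (cases "\<exists>b. ok m j c b")
      case True
      then have "ok m j c (SOME b. ok m j c b)" by (rule someI_ex)
      then show ?thesis using True g(2) by (auto simp: s_def ok_def)
    next
      case False
      then show ?thesis using a by (simp only: s_def case_prod_conv if_False)
    qed
    then show ?thesis by auto
  qed
  from steers_sequence[OF st, of s, OF this]
  obtain q where q: "subsequence_of q S"
    "\<And>m j b. j \<le> m \<Longrightarrow> dist ((T ^^ q m) (\<phi> (j, b))) (s m (j, truncate m b)) < 1 / real (Suc m)" by blast
  have "(\<lambda>i. (T ^^ q i) x) \<longlonglongrightarrow> g x" if x: "x \<in> E" for x
  proof (rule tendstoI)
    fix e :: real assume e: "e > 0"
    obtain j b where jb: "x = \<phi> (j, b)" using E x by auto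
    obtain d where d: "d > 0" "\<And>y. y \<in> E \<Longrightarrow> dist y x < d \<Longrightarrow> dist (g y) (g x) < e / 2"
      using g(1) x e unfolding continuous_on_iff by (meson half_gt_zero)
    have "\<forall>\<^sub>F m in sequentially. \<forall>c. dist (\<phi> (j, truncate m c)) (\<phi> (j, c)) < d / 2"
      using uniform_limitD[OF uniform_limit_comp_truncate[OF cont], of "d/2"] d(1) by auto
    moreover have "\<forall>\<^sub>F m in sequentially. 1 / real (Suc m) < e / 2"
      by (rule order_tendstoD(2)[OF lim_inverse_n'[THEN LIMSEQ_Suc]]) (use e in simp)
    moreover have "\<forall>\<^sub>F m in sequentially. j \<le> m" by (rule eventually_ge_at_top)
    ultimately show "\<forall>\<^sub>F m in sequentially. dist ((T ^^ q m) x) (g x) < e"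
    proof eventually_elim
      case (elim m)
      define c where "c = (SOME c. ok m j (truncate m b) c)"
      have ex: "\<exists>c. ok m j (truncate m b) c" using x jb by (auto simp: ok_def)
      then have c: "\<phi> (j, c) \<in> E" "truncate m c = truncate m b"
        using someI_ex[OF ex] by (auto simp: c_def ok_def)
      have "dist (\<phi> (j, c)) x < d"
        using elim(1)[rule_format, of c] elim(1)[rule_format, of b] c(2)
          dist_triangle3[of "\<phi> (j, c)" "\<phi> (j, b)" "\<phi> (j, truncate m b)"] by (simp add: jb)
      then have "dist (g (\<phi> (j, c))) (g x) < e/2" by (rule d(2)[OF c(1)])
      moreover have "dist ((T ^^ q m) x) (g (\<phi> (j, c))) < e/2"
        using q(2)[of j m b] elim(2,3) ex by (simp add: s_def jb c_def)
      ultimately show ?case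
        using dist_triangle[of "(T ^^ q m) x" "g x" "g (\<phi> (j, c))"] by linarith
    qed
  qed
  then show ?thesis using q(1) by blast
qed

section \<open>The two implications\<close>

lemma mixing_set_imp_cantor_approximation:
  assumes dyn: "dynamical_system X T" and mix: "mixing_set \<F> X T A" and S: "S \<in> dual_family \<F>"
  shows "\<exists>C :: nat \<Rightarrow> 'a::metric_space set.
       (\<forall>n\<ge>1. cantor_subset (C n) A \<and> C n \<subseteq> C (Suc n)) \<and>
       A \<subseteq> closure (\<Union>n\<in>{1..}. C n) \<and>
       (\<forall>n\<ge>1. \<forall>g. continuous_on (C n) g \<and> g ` C n \<subseteq> A \<longrightarrow>
          (\<exists>q. subsequence_of q S \<and> uniform_limit (C n) (\<lambda>i x. (T ^^ q i) x) g sequentially)) \<and>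
       (\<forall>E g. E \<subseteq> (\<Union>n\<in>{1..}. C n) \<and> continuous_on E g \<and> g ` E \<subseteq> A \<longrightarrow>
          (\<exists>q. subsequence_of q S \<and> (\<forall>x\<in>E. (\<lambda>i. (T ^^ q i) x) \<longlonglongrightarrow> g x)))"
proof -
  have cont: "continuous_on X T" and TX: "T ` X \<subseteq> X" and X: "compact X"
    using dyn unfolding dynamical_system_def homeomorphism_def by auto
  obtain x y where xy: "x \<in> A" "y \<in> A" "x \<noteq> y"
    using mix unfolding mixing_set_def by blast
  have A: "compact A"
    using mix X closedin_compact unfolding mixing_set_def by blast
  have "A \<noteq> {}" using xy by blast
  then obtain W :: "nat \<Rightarrow> 'a set" where W: "\<And>j. open (W j)" "\<And>j. W j \<inter> A \<noteq> {}"
    "\<And>U. open U \<Longrightarrow> U \<inter> A \<noteq> {} \<Longrightarrow> \<exists>j. closure (W j) \<subseteq> U"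
    using compact_countable_open_pi_base[OF A] by metis
  obtain \<phi> where \<phi>: "\<phi> \<in> block_maps A W" "steers S T A \<phi>"
    using exists_steered_map[OF mix S cont TX A, of W] W(1,2) by blast
  have cont\<phi>: "continuous_on UNIV (\<lambda>b. \<phi> (j, b))" and \<phi>W: "\<phi> (j, b) \<in> closure (A \<inter> W j)" for j b
    using \<phi>(1) by (auto simp: block_maps_def)
  have "closure (A \<inter> W j) \<subseteq> A" for j
    by (rule closure_minimal) (auto simp: compact_imp_closed[OF A])
  then have \<phi>A: "range \<phi> \<subseteq> A" using \<phi>W by fast
  have inj: "inj \<phi>" by (rule steers_inj[OF \<phi>(2) xy])
  define C where "C = (\<lambda>n::nat. \<phi> ` ({..n} \<times> UNIV))"
  have cantor: "cantor_subset (C n) A" for n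
  proof -
    obtain f :: "(nat \<Rightarrow> bool) \<Rightarrow> 'a"
      where f: "continuous_on UNIV f" "inj f" "range f = \<phi> ` ({..n} \<times> UNIV)"
      using injective_union_of_cantor_blocks[OF cont\<phi> inj] by blast
    have "cantor_subset (range f) A"
      by (rule cantor_subset_range[OF f(1,2)]) (use f(3) \<phi>A in auto)
    then show ?thesis by (simp only: C_def f(3))
  qed
  have mono: "C n \<subseteq> C (Suc n)" for n by (auto simp: C_def)
  have K: "(\<Union>n\<in>{1..}. C n) = range \<phi>"
  proof
    show "range \<phi> \<subseteq> (\<Union>n\<in>{1..}. C n)"
    proof clarify
      fix j b
      have "\<phi> (j, b) \<in> C (Suc j)" by (auto simp: C_def)
      then show "\<phi> (j, b) \<in> (\<Union>n\<in>{1..}. C n)" by (intro UN_I[of "Suc j"]) auto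
    qed
  qed (auto simp: C_def)
  have dense: "A \<subseteq> closure (range \<phi>)"
  proof
    fix a assume a: "a \<in> A"
    show "a \<in> closure (range \<phi>)"
      unfolding closure_approachable
    proof (intro allI impI)
      fix e :: real assume "e > 0"
      then have "a \<in> ball a e \<inter> A" using a by simp
      then obtain j where j: "closure (W j) \<subseteq> ball a e" using W(3)[of "ball a e"] by blast
      have "\<phi> (j, undefined) \<in> closure (W j)"
        using \<phi>W[of j undefined] closure_mono[of "A \<inter> W j" "W j"] by blast
      then have "dist (\<phi> (j, undefined)) a < e" using j by (auto simp: dist_commute subset_iff)
      then show "\<exists>y\<in>range \<phi>. dist y a < e" by blast
    qed
  qed
  have unif: "\<exists>q. subsequence_of q S \<and> uniform_limit (C n) (\<lambda>i x. (T ^^ q i) x) g sequentially"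
    if "continuous_on (C n) g" "g ` C n \<subseteq> A" for n g
    using steers_uniform_approximation[OF \<phi>(2) cont\<phi> xy(1) _ that] unfolding C_def by blast
  have pointwise: "\<exists>q. subsequence_of q S \<and> (\<forall>x\<in>E. (\<lambda>i. (T ^^ q i) x) \<longlonglongrightarrow> g x)"
    if "E \<subseteq> range \<phi>" "continuous_on E g" "g ` E \<subseteq> A" for E g
    using steers_pointwise_approximation[OF \<phi>(2) cont\<phi> xy(1) that] .
  show ?thesis
  proof (intro exI[of _ C] conjI allI impI, unfold K)
    fix n g assume "continuous_on (C n) g \<and> g ` C n \<subseteq> A"
    then show "\<exists>q. subsequence_of q S \<and> uniform_limit (C n) (\<lambda>i x. (T ^^ q i) x) g sequentially"
      by (intro unif) auto
  next
    fix E g assume "E \<subseteq> range \<phi> \<and> continuous_on E g \<and> g ` E \<subseteq> A"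
    then show "\<exists>q. subsequence_of q S \<and> (\<forall>x\<in>E. (\<lambda>i. (T ^^ q i) x) \<longlonglongrightarrow> g x)"
      by (intro pointwise) auto
  qed (rule cantor mono dense)+
qed

lemma infinite_distinct_representatives:
  assumes "finite I" "\<And>i. i \<in> I \<Longrightarrow> infinite (Z i)"
  shows "\<exists>x. inj_on x I \<and> (\<forall>i\<in>I. x i \<in> Z i)"
  using assms
proof (induction I rule: finite_induct)
  case (insert i I)
  then obtain x where x: "inj_on x I" "\<forall>i\<in>I. x i \<in> Z i" by auto
  have "infinite (Z i - x ` I)" using insert by (simp add: Diff_infinite_finite)
  then obtain z where z: "z \<in> Z i - x ` I" using infinite_imp_nonempty by blast
  have "inj_on (x(i := z)) (insert i I)"
    using x(1) z insert.hyps(2) by (auto simp: inj_on_def)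
  moreover have "\<forall>k\<in>insert i I. (x(i := z)) k \<in> Z k" using x(2) z by auto
  ultimately show ?case by blast
qed auto

text \<open>
  The complement of an intersection of hitting times that is not in \<open>\<F>\<close> would be in the dual
  family. That open sets meet \<open>K\<close> in infinitely many points makes it possible to choose the points \<open>x i\<close> distinct, although the sets \<open>U i\<close> may coincide; otherwise
  the prescribed map \<open>g\<close> would not be well defined.
\<close>

lemma pointwise_approximation_imp_mixing_set:
  fixes T :: "'a::metric_space \<Rightarrow> 'a"
  assumes TX: "T ` X \<subseteq> X" and fam: "furstenberg_family \<F>"
    and A: "closedin (top_of_set X) A" "\<exists>x\<in>A. \<exists>y\<in>A. x \<noteq> y"
    and approx: "\<And>S. S \<in> dual_family \<F> \<Longrightarrow> \<exists>K\<subseteq>A.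
      (\<forall>U. open U \<and> U \<inter> A \<noteq> {} \<longrightarrow> infinite (U \<inter> K)) \<and>
      (\<forall>E g. finite E \<and> E \<subseteq> K \<and> g ` E \<subseteq> A \<longrightarrow>
        (\<exists>q. subsequence_of q S \<and> (\<forall>x\<in>E. (\<lambda>i. (T ^^ q i) x) \<longlonglongrightarrow> g x)))"
  shows "mixing_set \<F> X T A"
  unfolding mixing_set_def
proof (intro conjI A allI impI)
  have AX: "A \<subseteq> X" using A(1) closedin_imp_subset by blast
  fix k :: nat and U V :: "nat \<Rightarrow> 'a set"
  assume UV: "\<forall>i\<in>{1..k}. openin (top_of_set X) (U i) \<and> U i \<inter> A \<noteq> {} \<and>
                    openin (top_of_set X) (V i) \<and> V i \<inter> A \<noteq> {}" and k: "1 \<le> k"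
  define F where "F = (\<Inter>i\<in>{1..k}. hitting_times X T (U i \<inter> A) (V i))"
  have F1: "F \<subseteq> {1..}" using k by (force simp: F_def hitting_times_def)
  show "F \<in> \<F>"
  proof (rule ccontr)
    assume "F \<notin> \<F>"
    then have "{1..} - F \<in> dual_family \<F>" using complement_in_dual_family[OF fam _ F1] by blast
    from approx[OF this] obtain K where K: "K \<subseteq> A"
      "\<And>U. open U \<Longrightarrow> U \<inter> A \<noteq> {} \<Longrightarrow> infinite (U \<inter> K)"
      "\<And>E g. finite E \<Longrightarrow> E \<subseteq> K \<Longrightarrow> g ` E \<subseteq> A \<Longrightarrow> \<exists>q. subsequence_of q ({1..} - F) \<and>
         (\<forall>x\<in>E. (\<lambda>i. (T ^^ q i) x) \<longlonglongrightarrow> g x)"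
      by (elim exE conjE) simp
    have "\<forall>i\<in>{1..k}. \<exists>U' V'. open U' \<and> U i = X \<inter> U' \<and> open V' \<and> V i = X \<inter> V'"
      using UV unfolding openin_open by blast
    then obtain U' V' where U': "\<And>i. i \<in> {1..k} \<Longrightarrow> open (U' i) \<and> U i = X \<inter> U' i"
      and V': "\<And>i. i \<in> {1..k} \<Longrightarrow> open (V' i) \<and> V i = X \<inter> V' i"
      by metis
    have "infinite (U' i \<inter> K)" if "i \<in> {1..k}" for i
    proof (rule K(2))
      have "X \<inter> U' i \<inter> A \<noteq> {}" using UV U'[OF that] that by metis
      then show "U' i \<inter> A \<noteq> {}" by blast
    qed (use U' that in blast)
    then obtain x where x: "inj_on x {1..k}" "\<And>i. i \<in> {1..k} \<Longrightarrow> x i \<in> U' i \<inter> K"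
      using infinite_distinct_representatives[of "{1..k}" "\<lambda>i. U' i \<inter> K"] by blast
    have "\<exists>y. i \<in> {1..k} \<longrightarrow> y \<in> V i \<inter> A" for i using UV by blast
    then obtain y where y: "\<And>i. i \<in> {1..k} \<Longrightarrow> y i \<in> V i \<inter> A" by metis
    define g where "g = (\<lambda>z. y (inv_into {1..k} x z))"
    have gx: "g (x i) = y i" if "i \<in> {1..k}" for i
      using that x(1) by (simp add: g_def)
    have "x ` {1..k} \<subseteq> K" "g ` x ` {1..k} \<subseteq> A" using x(2) y gx by auto
    from K(3)[OF _ this] obtain q where q0: "subsequence_of q ({1..} - F)"
      "\<forall>z\<in>x ` {1..k}. (\<lambda>n. (T ^^ q n) z) \<longlonglongrightarrow> g z"
      by blast
    then have q: "(\<lambda>n. (T ^^ q n) (x i)) \<longlonglongrightarrow> y i" if "i \<in> {1..k}" for i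
      using that gx[OF that] by force
    have "\<forall>\<^sub>F n in sequentially. \<forall>i\<in>{1..k}. (T ^^ q n) (x i) \<in> V' i"
    proof (intro eventually_ball_finite ballI)
      fix i assume i: "i \<in> {1..k}"
      show "\<forall>\<^sub>F n in sequentially. (T ^^ q n) (x i) \<in> V' i"
        using V'[OF i] y[OF i] by (intro topological_tendstoD[OF q[OF i]]) auto
    qed simp
    then obtain n where n: "\<And>i. i \<in> {1..k} \<Longrightarrow> (T ^^ q n) (x i) \<in> V' i"
      unfolding eventually_sequentially by blast
    have "q n \<in> {1..} - F" using q0(1) unfolding subsequence_of_def by blast
    moreover have "q n \<in> hitting_times X T (U i \<inter> A) (V i)" if i: "i \<in> {1..k}" for i
    proof -
      have "x i \<in> A" "x i \<in> X" "x i \<in> U i" using x(2)[OF i] K(1) AX U'[OF i] by auto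
      moreover have "(T ^^ q n) (x i) \<in> X"
        using funpow_closed[OF TX] calculation(2) by blast
      then have "(T ^^ q n) (x i) \<in> V i" using n[OF i] V'[OF i] by blast
      ultimately show ?thesis
        using \<open>q n \<in> {1..} - F\<close> unfolding hitting_times_def by blast
    qed
    ultimately show False unfolding F_def by blast
  qed
qed

theorem theorem3p3:
  fixes X :: "'a::metric_space set" and T :: "'a \<Rightarrow> 'a"
    and \<F> :: "nat set set" and A :: "'a set"
  assumes "dynamical_system X T"
    and "furstenberg_family \<F>"
    and "proper_family \<F>"
    and "\<forall>F\<in>\<F>. infinite F"
    and "closedin (top_of_set X) A"
    and "\<exists>x\<in>A. \<exists>y\<in>A. x \<noteq> y"
  shows "mixing_set \<F> X T A \<longleftrightarrow>
    (\<forall>S\<in>dual_family \<F>. \<exists>C :: nat \<Rightarrow> 'a set.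
       (\<forall>n\<ge>1. cantor_subset (C n) A \<and> C n \<subseteq> C (Suc n)) \<and>
       (let K = (\<Union>n\<in>{1..}. C n) in
          A \<subseteq> closure K \<and>
          (\<forall>n\<ge>1. \<forall>g. continuous_on (C n) g \<and> g ` C n \<subseteq> A \<longrightarrow>
             (\<exists>q. subsequence_of q S \<and>
                  uniform_limit (C n) (\<lambda>i x. (T ^^ q i) x) g sequentially)) \<and>
          (\<forall>E g. E \<subseteq> K \<and> continuous_on E g \<and> g ` E \<subseteq> A \<longrightarrow>
             (\<exists>q. subsequence_of q S \<and>
                  (\<forall>x\<in>E. (\<lambda>i. (T ^^ q i) x) \<longlonglongrightarrow> g x)))))"
  (is "_ \<longleftrightarrow> ?R")
proof
  assume mix: "mixing_set \<F> X T A"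
  show ?R
    unfolding Let_def by (rule ballI) (rule mixing_set_imp_cantor_approximation[OF assms(1) mix])
next
  assume R: ?R
  have TX: "T ` X \<subseteq> X"
    using assms(1) unfolding dynamical_system_def homeomorphism_def by auto
  show "mixing_set \<F> X T A"
  proof (rule pointwise_approximation_imp_mixing_set[OF TX assms(2,5,6)])
    fix S assume S: "S \<in> dual_family \<F>"
    obtain C :: "nat \<Rightarrow> 'a set" where C: "\<forall>n\<ge>1. cantor_subset (C n) A \<and> C n \<subseteq> C (Suc n)"
      "A \<subseteq> closure (\<Union>n\<in>{1..}. C n)"
      "\<forall>E g. E \<subseteq> (\<Union>n\<in>{1..}. C n) \<and> continuous_on E g \<and> g ` E \<subseteq> A \<longrightarrow>
         (\<exists>q. subsequence_of q S \<and> (\<forall>x\<in>E. (\<lambda>i. (T ^^ q i) x) \<longlonglongrightarrow> g x))"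
      using bspec[OF R[unfolded Let_def] S] by (elim exE conjE) (rule that; assumption)
    define K where "K = (\<Union>n\<in>{1..}. C n)"
    have KA: "K \<subseteq> A" using C(1) by (auto simp: K_def cantor_subset_def)
    have inf: "infinite (U \<inter> K)" if U: "open U" "U \<inter> A \<noteq> {}" for U
    proof -
      have "U \<inter> K \<noteq> {}" using U C(2) open_Int_closure_eq_empty[OF U(1)] unfolding K_def by blast
      then obtain n where n: "n \<ge> 1" "U \<inter> C n \<noteq> {}" unfolding K_def by auto
      then have "infinite (U \<inter> C n)" using infinite_Int_cantor_subset[OF _ U(1)] C(1) by blast
      moreover have "U \<inter> C n \<subseteq> U \<inter> K" using n(1) unfolding K_def by auto
      ultimately show ?thesis using finite_subset by blast
    qed
    have approx: "\<exists>q. subsequence_of q S \<and> (\<forall>x\<in>E. (\<lambda>i. (T ^^ q i) x) \<longlonglongrightarrow> g x)"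
      if "finite E" "E \<subseteq> K" "g ` E \<subseteq> A" for E g
      using C(3)[THEN spec[of _ E], THEN spec[of _ g]] that continuous_on_finite[of E g]
      unfolding K_def by blast
    show "\<exists>K\<subseteq>A. (\<forall>U. open U \<and> U \<inter> A \<noteq> {} \<longrightarrow> infinite (U \<inter> K)) \<and>
      (\<forall>E g. finite E \<and> E \<subseteq> K \<and> g ` E \<subseteq> A \<longrightarrow>
        (\<exists>q. subsequence_of q S \<and> (\<forall>x\<in>E. (\<lambda>i. (T ^^ q i) x) \<longlonglongrightarrow> g x)))"
      using KA inf approx by (intro exI[of _ K] conjI allI impI) simp_all
  qed
qed

end
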